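(* Let $1\le m<d$, let $\mu=(\mu_1,\dots,\mu_d)\in\mathbb{R}^d/\mathbb{R}{\bf 1}$, and let $L(A)$ be a Stiefel tropical linear space, of an $m\times d$ matrix $A$ over $\mathbb{R}\cup\{-\infty\}$, that passes through $\mu$ (i.e. $\mu\in L(A)$). For $\sigma>0$ let $X=(\mu_1+\epsilon_1,\dots,\mu_d+\epsilon_d)$, where $\epsilon_1,\dots,\epsilon_d$ are independent Gaussian random variables with mean $0$ and standard deviation $\sigma$, and let $X'$ be the projected point of $X$ onto $L(A)$. Then $\mathbb{E}[d_{\rm tr}(X,X')]\to 0$ as $\sigma\to 0$.
   Context: ${\bf 1}=(1,\dots,1)$, $[d]=\{1,\dots,d\}$. Tropical distance: $d_{\rm tr}(v,w)=\max_i(v_i-w_i)-\min_i(v_i-w_i)$. The tropical determinant of a $q\times q$ matrix $B$ over $\mathbb{R}\cup\{-\infty\}$ is $\mathrm{tdet}(B)=\max_{\sigma\in S_q}\sum_{i}B_{i,\sigma(i)}$. For an $m\times d$ matrix $A$ with $m<d$, $p_A(\omega)=\mathrm{tdet}(A_\omega)$ for $m$-subsets $\omega\subseteq[d]$, where $A_\omega$ consists of the columns of $A$ indexed by $\omega$; these are the tropical Plücker coordinates, assumed not all equal to $-\infty$. The Stiefel tropical linear space $L(A)$ is the set of $x\in(\mathbb{R}\cup\{-\infty\})^d/\mathbb{R}{\bf 1}$ such that for every $(m+1)$-subset $\tau\subseteq[d]$ the maximum of $p_A(\tau\setminus\{t\})+x_t$ over $t\in\tau$ is attained at least twice. The projected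 point of $u\in\mathbb{R}^d/\mathbb{R}{\bf 1}$ onto $L(A)$ is the point $w$ given by the Blue Rule: $w_i=\max_{\tau}\min_{j\notin\tau}\{u_j+p_A(\tau\cup\{i\})-p_A(\tau\cup\{j\})\}$, where $\tau$ runs over $(m-1)$-subsets of $[d]$ not containing $i$ (only $\tau$ with $p_A(\tau\cup\{i\})\ne-\infty$ and $j$ with $p_A(\tau\cup\{j\})\neq-\infty$ are considered); it is a known fact that $w\in L(A)$ and $w$ minimizes $d_{\rm tr}(u,\cdot)$ over $L(A)$. *)

theory Defs
  imports "HOL-Probability.Probability" "HOL-Combinatorics.Permutations"
begin

text \<open>
  Vectors and matrices are functions on \<^typ>\<open>nat\<close> of which only the entries with index in
  \<open>{1..d}\<close> (rows: \<open>{1..m}\<close>) matter. The tropical semiring is \<^typ>\<open>ereal\<close> without \<open>\<infinity>\<close>.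
  Points modulo \<open>\<real>\<one>\<close> are given by representatives; the lemmas below show that nothing
  depends on their choice.
\<close>

definition trop_dist :: "nat \<Rightarrow> (nat \<Rightarrow> ereal) \<Rightarrow> (nat \<Rightarrow> ereal) \<Rightarrow> ereal" where
  "trop_dist d v w =
     Max ((\<lambda>i. v i - w i) ` {1..d}) - Min ((\<lambda>i. v i - w i) ` {1..d})"

definition tdet :: "nat \<Rightarrow> (nat \<Rightarrow> nat \<Rightarrow> ereal) \<Rightarrow> ereal" where
  "tdet q B = Max ((\<lambda>\<pi>. \<Sum>i\<in>{1..q}. B i (\<pi> i)) ` {\<pi>. \<pi> permutes {1..q}})"

text \<open>The columns indexed by \<open>\<omega>\<close>, in increasing order and renumbered from 1.\<close>

definition col_submatrix :: "(nat \<Rightarrow> nat \<Rightarrow> ereal) \<Rightarrow> nat set \<Rightarrow> nat \<Rightarrow> nat \<Rightarrow> ereal" where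
  "col_submatrix A \<omega> = (\<lambda>i j. A i (sorted_list_of_set \<omega> ! (j - 1)))"

definition plucker :: "nat \<Rightarrow> (nat \<Rightarrow> nat \<Rightarrow> ereal) \<Rightarrow> nat set \<Rightarrow> ereal" where
  "plucker m A \<omega> = tdet m (col_submatrix A \<omega>)"

definition trop_matrix :: "nat \<Rightarrow> nat \<Rightarrow> (nat \<Rightarrow> nat \<Rightarrow> ereal) \<Rightarrow> bool" where
  "trop_matrix m d A \<longleftrightarrow>
     (\<forall>i\<in>{1..m}. \<forall>j\<in>{1..d}. A i j \<noteq> \<infinity>) \<and>
     (\<exists>\<omega>. \<omega> \<subseteq> {1..d} \<and> card \<omega> = m \<and> plucker m A \<omega> \<noteq> -\<infinity>)"

definition stiefel_space :: "nat \<Rightarrow> nat \<Rightarrow> (nat \<Rightarrow> nat \<Rightarrow> ereal) \<Rightarrow> (nat \<Rightarrow> ereal) set" where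
  "stiefel_space m d A =
     {x. (\<forall>i\<in>{1..d}. x i \<noteq> \<infinity>) \<and>
         (\<forall>\<tau>. \<tau> \<subseteq> {1..d} \<and> card \<tau> = m + 1 \<longrightarrow>
            2 \<le> card {t \<in> \<tau>. plucker m A (\<tau> - {t}) + x t
                        = Max ((\<lambda>s. plucker m A (\<tau> - {s}) + x s) ` \<tau>)})}"

text \<open>
  The Blue Rule. The suprema and infima range over finite sets; the infimum is over a set
  containing \<open>j = i\<close>, and the supremum over no \<open>\<tau>\<close> at all is \<open>-\<infinity>\<close>.
\<close>

definition blue_proj :: "nat \<Rightarrow> nat \<Rightarrow> (nat \<Rightarrow> nat \<Rightarrow> ereal) \<Rightarrow> (nat \<Rightarrow> real) \<Rightarrow> nat \<Rightarrow> ereal" where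
  "blue_proj m d A u i =
     (SUP \<tau>\<in>{\<tau>. \<tau> \<subseteq> {1..d} \<and> card \<tau> = m - 1 \<and> i \<notin> \<tau> \<and> plucker m A (\<tau> \<union> {i}) \<noteq> -\<infinity>}.
        INF j\<in>{j \<in> {1..d} - \<tau>. plucker m A (\<tau> \<union> {j}) \<noteq> -\<infinity>}.
          ereal (u j) + plucker m A (\<tau> \<union> {i}) - plucker m A (\<tau> \<union> {j}))"

lemma trop_dist_nonneg:
  assumes "1 \<le> d"
  shows "0 \<le> trop_dist d v w"
proof -
  have "Min ((\<lambda>i. v i - w i) ` {1..d}) \<le> Max ((\<lambda>i. v i - w i) ` {1..d})"
    using assms by (intro order_trans[OF Min_le[of _ "v 1 - w 1"] Max_ge]) auto
  then show ?thesis
    unfolding trop_dist_def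
    by (cases "Min ((\<lambda>i. v i - w i) ` {1..d})"; cases "Max ((\<lambda>i. v i - w i) ` {1..d})") auto
qed

lemma Max_add_real_ereal:
  assumes "finite S" "S \<noteq> {}"
  shows "Max ((\<lambda>x. f x + ereal c) ` S) = Max (f ` S) + ereal c"
  using mono_Max_commute[of "\<lambda>y. y + ereal c" "f ` S"] assms
  by (simp add: image_image mono_def add_right_mono)

lemma Min_add_real_ereal:
  assumes "finite S" "S \<noteq> {}"
  shows "Min ((\<lambda>x. f x + ereal c) ` S) = Min (f ` S) + ereal c"
  using mono_Min_commute[of "\<lambda>y. y + ereal c" "f ` S"] assms
  by (simp add: image_image mono_def add_right_mono)

lemma trop_dist_shift:
  assumes "1 \<le> d"
  shows "trop_dist d (\<lambda>i. v i + ereal a) (\<lambda>i. w i + ereal b) = trop_dist d v w"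
proof -
  have *: "v i + ereal a - (w i + ereal b) = (v i - w i) + ereal (a - b)" for i
    by (cases "v i"; cases "w i") auto
  have **: "x + ereal c - (y + ereal c) = x - y" for x y c
    by (cases x; cases y) auto
  show ?thesis
    using assms unfolding trop_dist_def *
    by (simp add: Max_add_real_ereal Min_add_real_ereal **)
qed

lemma stiefel_space_shift:
  "(\<lambda>i. x i + ereal c) \<in> stiefel_space m d A \<longleftrightarrow> x \<in> stiefel_space m d A"
proof -
  have inf: "x i + ereal c \<noteq> \<infinity> \<longleftrightarrow> x i \<noteq> \<infinity>" for i
    by (cases "x i") auto
  have eq: "a + ereal c = b + ereal c \<longleftrightarrow> a = b" for a b
    by (cases a; cases b) auto
  have "{t \<in> \<tau>. plucker m A (\<tau> - {t}) + (x t + ereal c)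
           = Max ((\<lambda>s. plucker m A (\<tau> - {s}) + (x s + ereal c)) ` \<tau>)}
      = {t \<in> \<tau>. plucker m A (\<tau> - {t}) + x t
           = Max ((\<lambda>s. plucker m A (\<tau> - {s}) + x s) ` \<tau>)}"
    if "\<tau> \<subseteq> {1..d}" for \<tau>
  proof (cases "\<tau> = {}")
    case False
    moreover have "finite \<tau>"
      using that finite_subset by blast
    ultimately show ?thesis
      unfolding add.assoc[symmetric] by (simp add: Max_add_real_ereal eq)
  qed simp
  then show ?thesis
    unfolding stiefel_space_def mem_Collect_eq inf by (metis (no_types, lifting))
qed

lemma SUP_add_real_ereal: "(SUP x\<in>S. f x + ereal c) = (SUP x\<in>S. f x) + ereal c"
  by (cases "S = {}") (auto simp: SUP_ereal_add_left bot_ereal_def)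

lemma INF_add_real_ereal: "(INF x\<in>S. f x + ereal c) = (INF x\<in>S. f x) + ereal c"
proof (rule antisym)
  have le: "a \<le> b + ereal (- c)" if "a + ereal c \<le> b" for a b c
    using that by (cases a; cases b) auto
  have le': "a + ereal c \<le> b" if "a \<le> b + ereal (- c)" for a b c
    using that by (cases a; cases b) auto
  have "(INF x\<in>S. f x + ereal c) + ereal (- c) \<le> (INF x\<in>S. f x)"
    by (intro INF_greatest le') (auto intro: INF_lower)
  then show "(INF x\<in>S. f x + ereal c) \<le> (INF x\<in>S. f x) + ereal c"
    using le[of _ "- c"] by simp
  show "(INF x\<in>S. f x) + ereal c \<le> (INF x\<in>S. f x + ereal c)"
    by (intro INF_greatest add_right_mono INF_lower)
qed

lemma blue_proj_shift:
  "blue_proj m d A (\<lambda>j. u j + c) i = blue_proj m d A u i + ereal c"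
proof -
  have *: "ereal (u j + c) + p - q = (ereal (u j) + p - q) + ereal c" for j p q
    by (cases p; cases q) auto
  show ?thesis
    unfolding blue_proj_def * by (simp only: SUP_add_real_ereal INF_add_real_ereal)
qed

end

theory Submission
  imports Defs
begin

text \<open>
  The Blue Rule has three properties that together force the distance to be small.
  It never exceeds its argument, because the choice \<open>j = i\<close> is always available in the
  minimum. It is monotone and commutes with adding a constant, hence is nonexpansive for the
  sup norm. And it fixes the real points of the tropical linear space
  (\<open>blue_proj_fixes_stiefel_space\<close>).

  So let \<open>u\<close> differ from a real point \<open>\<mu>\<close> of the space by at most \<open>\<delta>\<close> in each
  coordinate. Its projection lies coordinatewise between \<open>\<mu> - \<delta>\<close> and \<open>u\<close>, hence
  between \<open>u - 2\<delta>\<close> and \<open>u\<close>, and the tropical distance from \<open>u\<close> to its projection is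
  at most \<open>2\<delta>\<close> (\<open>trop_dist_blue_proj_le\<close>). For the Gaussian perturbation, \<open>\<delta>\<close> can be
  taken to be \<open>\<Sum>i. \<bar>\<epsilon>\<^sub>i\<bar>\<close>, whose expectation is
  \<open>d * \<sigma> * sqrt (2 / pi)\<close>. This tends to 0 with \<open>\<sigma>\<close>.

  The fixed point property is where membership in the space enters. Weight each \<open>m\<close>-set
  \<open>\<omega>\<close> by \<open>plucker m A \<omega> - (\<Sum>k\<in>\<omega>. \<mu> k)\<close>. The condition that maxima are attained twice
  says that the sets of largest weight cover all indices
  (\<open>maximal_weight_set_through\<close>); removing \<open>i\<close> from such a set that contains it gives a
  \<open>\<tau>\<close> for which the minimum in the Blue Rule is attained at \<open>j = i\<close>.
\<close>

section \<open>Index sets of maximal weight\<close>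

lemma plucker_neq_PInf:
  assumes "trop_matrix m d A" "\<omega> \<subseteq> {1..d}" "card \<omega> = m"
  shows "plucker m A \<omega> \<noteq> \<infinity>"
proof -
  have fin: "finite \<omega>"
    using assms(2) finite_subset by blast
  have entry: "col_submatrix A \<omega> i j \<noteq> \<infinity>" if "i \<in> {1..m}" "j \<in> {1..m}" for i j
  proof -
    have "sorted_list_of_set \<omega> ! (j - 1) \<in> set (sorted_list_of_set \<omega>)"
      using that assms(3) fin by (intro nth_mem) auto
    then show ?thesis
      using that assms fin unfolding trop_matrix_def col_submatrix_def by auto
  qed
  have "(\<Sum>i\<in>{1..m}. col_submatrix A \<omega> i (\<pi> i)) \<noteq> \<infinity>" if "\<pi> permutes {1..m}" for \<pi>
    using entry permutes_in_image[OF that] by (simp add: sum_Pinfty)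
  moreover have "plucker m A \<omega>
      \<in> (\<lambda>\<pi>. \<Sum>i\<in>{1..m}. col_submatrix A \<omega> i (\<pi> i)) ` {\<pi>. \<pi> permutes {1..m}}"
    unfolding plucker_def tdet_def
    by (intro Max_in finite_imageI finite_permutations) (auto intro: permutes_id)
  ultimately show ?thesis
    by (elim imageE) simp
qed

text \<open>
  If \<open>\<omega>\<close> has maximal weight and misses \<open>i\<close>, apply the defining condition to
  \<open>\<tau> = \<omega> \<union> {i}\<close>. Up to the constant \<open>\<Sum>k\<in>\<tau>. u k\<close> the terms compared there are the
  weights of the sets \<open>\<tau> - {t}\<close>, so the maximum is attained at \<open>t = i\<close>, and the second
  place \<open>t\<close> where it is attained exchanges \<open>t\<close> for \<open>i\<close> at no loss of weight.
\<close>

lemma maximal_weight_set_through: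
  fixes u :: "nat \<Rightarrow> real"
  assumes A: "trop_matrix m d A" and u: "(\<lambda>i. ereal (u i)) \<in> stiefel_space m d A"
    and i: "i \<in> {1..d}"
  obtains \<omega> where "\<omega> \<subseteq> {1..d}" "card \<omega> = m" "i \<in> \<omega>" "plucker m A \<omega> \<noteq> -\<infinity>"
    "\<And>\<omega>'. \<omega>' \<subseteq> {1..d} \<Longrightarrow> card \<omega>' = m \<Longrightarrow>
       plucker m A \<omega>' - ereal (sum u \<omega>') \<le> plucker m A \<omega> - ereal (sum u \<omega>)"
proof -
  define q where "q \<omega> = plucker m A \<omega> - ereal (sum u \<omega>)" for \<omega>
  define B where "B = {\<omega>. \<omega> \<subseteq> {1..d} \<and> card \<omega> = m}"
  obtain \<omega>0 where \<omega>0: "\<omega>0 \<in> B" "plucker m A \<omega>0 \<noteq> -\<infinity>"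
    using A unfolding trop_matrix_def B_def by auto
  have "finite B"
    unfolding B_def by simp
  then have "Max (q ` B) \<in> q ` B"
    using \<omega>0(1) by (intro Max_in) auto
  then obtain \<omega> where \<omega>: "\<omega> \<in> B" "q \<omega> = Max (q ` B)"
    by auto
  have max: "q \<omega>' \<le> q \<omega>" if "\<omega>' \<in> B" for \<omega>'
    using that \<open>finite B\<close> unfolding \<omega>(2) by (intro Max_ge) auto
  \<comment> \<open>A set of maximal weight outweighs \<open>\<omega>0\<close>, whose weight is finite.\<close>
  have neq_MInf: "plucker m A \<omega>' \<noteq> -\<infinity>" if "q \<omega>' = q \<omega>" for \<omega>'
    using max[OF \<omega>0(1)] \<omega>0(2) that[symmetric] unfolding q_def
    by (cases "plucker m A \<omega>0") auto
  have "\<exists>\<omega>'\<in>B. i \<in> \<omega>' \<and> q \<omega>' = q \<omega>"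
  proof (cases "i \<in> \<omega>")
    case False
    define \<tau> where "\<tau> = insert i \<omega>"
    have fin: "finite \<omega>" and \<tau>: "\<tau> \<subseteq> {1..d}" "card \<tau> = m + 1"
      using \<omega>(1) i False finite_subset[of \<omega>] unfolding B_def \<tau>_def by auto
    have remove: "\<tau> - {t} \<in> B" if "t \<in> \<tau>" for t
      using \<tau> that unfolding B_def by (auto simp: card_Diff_singleton_if)
    have weight: "plucker m A (\<tau> - {t}) + ereal (u t) = q (\<tau> - {t}) + ereal (sum u \<tau>)"
      if "t \<in> \<tau>" for t
    proof -
      have "sum u \<tau> = u t + sum u (\<tau> - {t})"
        using that fin unfolding \<tau>_def by (intro sum.remove) auto
      then show ?thesis
        unfolding q_def by (cases "plucker m A (\<tau> - {t})") auto
    qed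
    have "\<tau> - {i} = \<omega>"
      using False unfolding \<tau>_def by auto
    then have "Max ((\<lambda>t. plucker m A (\<tau> - {t}) + ereal (u t)) ` \<tau>) = q \<omega> + ereal (sum u \<tau>)"
      using fin max remove weight unfolding \<tau>_def
      by (intro Max_eqI) (auto intro!: add_right_mono image_eqI[where x = i])
    then have "2 \<le> card {t \<in> \<tau>. plucker m A (\<tau> - {t}) + ereal (u t) = q \<omega> + ereal (sum u \<tau>)}"
      using u \<tau> unfolding stiefel_space_def by auto
    then have "\<not> {t \<in> \<tau>. plucker m A (\<tau> - {t}) + ereal (u t) = q \<omega> + ereal (sum u \<tau>)} \<subseteq> {i}"
      by (intro notI) (drule card_mono[rotated], simp_all)
    then obtain t where t: "t \<in> \<tau>" "t \<noteq> i"
        "plucker m A (\<tau> - {t}) + ereal (u t) = q \<omega> + ereal (sum u \<tau>)"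
      by auto
    then have "q (\<tau> - {t}) + ereal (sum u \<tau>) = q \<omega> + ereal (sum u \<tau>)"
      using weight by simp
    then have "q (\<tau> - {t}) = q \<omega>"
      by (cases "q (\<tau> - {t})"; cases "q \<omega>") auto
    moreover have "i \<in> \<tau> - {t}"
      using t(2) unfolding \<tau>_def by auto
    ultimately show ?thesis
      using remove[OF t(1)] by (intro bexI[of _ "\<tau> - {t}"] conjI)
  qed (use \<omega> in auto)
  then obtain \<omega>' where \<omega>': "\<omega>' \<in> B" "i \<in> \<omega>'" "q \<omega>' = q \<omega>"
    by auto
  show thesis
    by (rule that[of \<omega>']) (use \<omega>' neq_MInf max in \<open>auto simp: B_def q_def\<close>)
qed

section \<open>The Blue Rule near a real point of the space\<close>

text \<open>
  Each \<open>\<tau>\<close> contributes at most \<open>u i\<close>, the value at \<open>j = i\<close>; the Pluecker coordinates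
  cancel there because the one at \<open>\<tau> \<union> {i}\<close> is finite.
\<close>

lemma blue_proj_le:
  assumes "1 \<le> m" "trop_matrix m d A" "i \<in> {1..d}"
  shows "blue_proj m d A u i \<le> ereal (u i)"
  unfolding blue_proj_def
proof (intro SUP_least, elim CollectE conjE)
  fix \<tau> assume \<tau>: "\<tau> \<subseteq> {1..d}" "card \<tau> = m - 1" "i \<notin> \<tau>" "plucker m A (\<tau> \<union> {i}) \<noteq> -\<infinity>"
  have "finite \<tau>"
    using \<tau>(1) finite_subset by blast
  then have "plucker m A (\<tau> \<union> {i}) \<noteq> \<infinity>"
    using \<tau> assms by (intro plucker_neq_PInf) auto
  with \<tau> have "ereal (u i) + plucker m A (\<tau> \<union> {i}) - plucker m A (\<tau> \<union> {i}) = ereal (u i)"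
    by (cases "plucker m A (\<tau> \<union> {i})") auto
  then show "(INF j\<in>{j \<in> {1..d} - \<tau>. plucker m A (\<tau> \<union> {j}) \<noteq> -\<infinity>}.
      ereal (u j) + plucker m A (\<tau> \<union> {i}) - plucker m A (\<tau> \<union> {j})) \<le> ereal (u i)"
    using \<tau> assms(3) by (intro INF_lower2[of i]) auto
qed

lemma blue_proj_mono:
  assumes "\<And>j. j \<in> {1..d} \<Longrightarrow> u j \<le> v j"
  shows "blue_proj m d A u i \<le> blue_proj m d A v i"
  unfolding blue_proj_def
  by (intro SUP_mono' INF_superset_mono order_refl ereal_minus_mono add_right_mono)
    (use assms in auto)

text \<open>
  Passing from \<open>\<tau> \<union> {j}\<close> to \<open>\<tau> \<union> {i}\<close> changes the weight by
  \<open>(plucker m A (\<tau> \<union> {i}) - u i) - (plucker m A (\<tau> \<union> {j}) - u j)\<close>. If \<open>\<tau> \<union> {i}\<close> has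
  maximal weight, this is nonnegative for every \<open>j\<close>, which says that \<open>u i\<close> is a lower
  bound for the terms that the Blue Rule minimizes for this \<open>\<tau>\<close>.
\<close>

theorem blue_proj_fixes_stiefel_space:
  fixes u :: "nat \<Rightarrow> real"
  assumes m: "1 \<le> m" and A: "trop_matrix m d A"
    and u: "(\<lambda>i. ereal (u i)) \<in> stiefel_space m d A" and i: "i \<in> {1..d}"
  shows "blue_proj m d A u i = ereal (u i)"
proof (rule antisym[OF blue_proj_le[OF m A i]])
  obtain \<omega> where \<omega>: "\<omega> \<subseteq> {1..d}" "card \<omega> = m" "i \<in> \<omega>" "plucker m A \<omega> \<noteq> -\<infinity>"
    and max: "\<And>\<omega>'. \<omega>' \<subseteq> {1..d} \<Longrightarrow> card \<omega>' = m \<Longrightarrow>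
       plucker m A \<omega>' - ereal (sum u \<omega>') \<le> plucker m A \<omega> - ereal (sum u \<omega>)"
    by (rule maximal_weight_set_through[OF A u i]) metis
  define \<tau> where "\<tau> = \<omega> - {i}"
  have fin: "finite \<tau>"
    using \<omega>(1) finite_subset unfolding \<tau>_def by blast
  have \<tau>: "\<tau> \<subseteq> {1..d}" "card \<tau> = m - 1" "i \<notin> \<tau>" "\<tau> \<union> {i} = \<omega>"
    using \<omega> unfolding \<tau>_def by (auto simp: card_Diff_singleton_if)
  have "ereal (u i) \<le> ereal (u j) + plucker m A \<omega> - plucker m A (\<tau> \<union> {j})"
    if j: "j \<in> {1..d} - \<tau>" "plucker m A (\<tau> \<union> {j}) \<noteq> -\<infinity>" for j
  proof -
    have \<tau>j: "\<tau> \<union> {j} \<subseteq> {1..d}" "card (\<tau> \<union> {j}) = m"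
      using \<tau> j fin m by auto
    have "sum u \<omega> = u i + sum u \<tau>" "sum u (\<tau> \<union> {j}) = u j + sum u \<tau>"
      using \<tau>(3) j fin unfolding \<tau>(4)[symmetric] by auto
    then show ?thesis
      using max[OF \<tau>j] plucker_neq_PInf[OF A \<tau>j] plucker_neq_PInf[OF A \<omega>(1,2)] \<omega>(4) j(2)
      by (cases "plucker m A \<omega>"; cases "plucker m A (\<tau> \<union> {j})") auto
  qed
  then show "ereal (u i) \<le> blue_proj m d A u i"
    unfolding blue_proj_def using \<tau> \<omega>(4)
    by (intro SUP_upper2[of \<tau>] INF_greatest) auto
qed

lemma trop_dist_le:
  assumes "1 \<le> d" "\<And>i. i \<in> {1..d} \<Longrightarrow> ereal a \<le> v i - w i"
    "\<And>i. i \<in> {1..d} \<Longrightarrow> v i - w i \<le> ereal b"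
  shows "trop_dist d v w \<le> ereal (b - a)"
proof -
  have "Max ((\<lambda>i. v i - w i) ` {1..d}) \<le> ereal b" "ereal a \<le> Min ((\<lambda>i. v i - w i) ` {1..d})"
    using assms by auto
  then have "trop_dist d v w \<le> ereal b - ereal a"
    unfolding trop_dist_def by (rule ereal_minus_mono)
  then show ?thesis
    by simp
qed

lemma trop_dist_blue_proj_le:
  fixes u \<mu> :: "nat \<Rightarrow> real"
  assumes "1 \<le> m" "1 \<le> d" "trop_matrix m d A"
    and "(\<lambda>i. ereal (\<mu> i)) \<in> stiefel_space m d A"
    and \<delta>: "\<And>i. i \<in> {1..d} \<Longrightarrow> \<bar>u i - \<mu> i\<bar> \<le> \<delta>"
  shows "trop_dist d (\<lambda>i. ereal (u i)) (blue_proj m d A u) \<le> ereal (2 * \<delta>)"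
proof -
  have "ereal 0 \<le> ereal (u i) - blue_proj m d A u i \<and>
      ereal (u i) - blue_proj m d A u i \<le> ereal (2 * \<delta>)" if i: "i \<in> {1..d}" for i
  proof -
    \<comment> \<open>The translate \<open>\<mu> - \<delta>\<close> is fixed along with \<open>\<mu>\<close> and lies below \<open>u\<close>.\<close>
    have "ereal (\<mu> i + - \<delta>) = blue_proj m d A (\<lambda>j. \<mu> j + - \<delta>) i"
      using assms i by (simp only: blue_proj_shift blue_proj_fixes_stiefel_space) simp
    also have "\<dots> \<le> blue_proj m d A u i"
      using \<delta> by (intro blue_proj_mono) (force simp: abs_le_iff)
    finally show ?thesis
      using blue_proj_le[of m d A i u] assms(1,3) i \<delta>[OF i]
      by (cases "blue_proj m d A u i") auto
  qed
  then show ?thesis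
    using trop_dist_le[of d 0 "\<lambda>i. ereal (u i)" "blue_proj m d A u" "2 * \<delta>"] assms(2) by simp
qed

section \<open>Gaussian perturbations\<close>

lemma measurable_blue_proj:
  assumes "\<And>j. j \<in> {1..d} \<Longrightarrow> (\<lambda>x. U x j) \<in> borel_measurable N"
  shows "(\<lambda>x. blue_proj m d A (U x) i) \<in> borel_measurable N"
  unfolding blue_proj_def
proof (intro borel_measurable_SUP borel_measurable_INF countable_finite)
  show "finite {\<tau>. \<tau> \<subseteq> {1..d} \<and> card \<tau> = m - 1 \<and> i \<notin> \<tau> \<and> plucker m A (\<tau> \<union> {i}) \<noteq> -\<infinity>}"
    by (rule finite_subset[of _ "Pow {1..d}"]) auto
qed (use assms in \<open>auto intro!: borel_measurable_ereal_diff borel_measurable_ereal_add\<close>)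

lemma measurable_trop_dist:
  assumes "\<And>i. i \<in> {1..d} \<Longrightarrow> (\<lambda>x. V x i) \<in> borel_measurable N"
    "\<And>i. i \<in> {1..d} \<Longrightarrow> (\<lambda>x. W x i) \<in> borel_measurable N"
  shows "(\<lambda>x. trop_dist d (V x) (W x)) \<in> borel_measurable N"
  unfolding trop_dist_def using assms
  by (intro borel_measurable_ereal_diff borel_measurable_Max borel_measurable_Min) auto

lemma nn_integral_abs_centered_normal:
  fixes Z :: "'w \<Rightarrow> real"
  assumes "\<sigma> > 0" "distributed N lborel Z (\<lambda>x. ennreal (normal_density 0 \<sigma> x))"
  shows "(\<integral>\<^sup>+\<omega>. ennreal \<bar>Z \<omega>\<bar> \<partial>N) = ennreal (\<sigma> * sqrt (2 / pi))"
proof -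
  have "(\<integral>\<^sup>+\<omega>. ennreal \<bar>Z \<omega>\<bar> \<partial>N)
      = (\<integral>\<^sup>+x. ennreal (normal_density 0 \<sigma> x) * ennreal \<bar>x\<bar> \<partial>lborel)"
    using assms(2) by (intro distributed_nn_integral[symmetric]) auto
  \<comment> \<open>The first absolute moment, as the case \<open>k = 0\<close> of the absolute moments of order \<open>2 * k + 1\<close>.\<close>
  also have "\<dots> = (\<integral>\<^sup>+x. ennreal (normal_density 0 \<sigma> x * \<bar>x - 0\<bar> ^ (2 * 0 + 1)) \<partial>lborel)"
    by (simp add: ennreal_mult)
  also have "\<dots> = ennreal (\<sigma> * sqrt (2 / pi))"
    using normal_moment_abs_odd[OF assms(1), of 0 0]
    by (subst nn_integral_eq_integral)
      (auto simp: has_bochner_integral_iff simp del: power_one_right)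
  finally show ?thesis .
qed

theorem theorem15:
  fixes m d :: nat
    and A :: "nat \<Rightarrow> nat \<Rightarrow> ereal"
    and \<mu> :: "nat \<Rightarrow> real"
    and M :: "real \<Rightarrow> 'w measure"
    and \<epsilon> :: "real \<Rightarrow> nat \<Rightarrow> 'w \<Rightarrow> real"
    and X :: "real \<Rightarrow> 'w \<Rightarrow> nat \<Rightarrow> real"
    and X' :: "real \<Rightarrow> 'w \<Rightarrow> nat \<Rightarrow> ereal"
  assumes "1 \<le> m" and "m < d"
    and "trop_matrix m d A"
    and "(\<lambda>i. ereal (\<mu> i)) \<in> stiefel_space m d A"
    and "\<And>\<sigma>. \<sigma> > 0 \<Longrightarrow> prob_space (M \<sigma>)"
    and "\<And>\<sigma>. \<sigma> > 0 \<Longrightarrow> prob_space.indep_vars (M \<sigma>) (\<lambda>_. borel) (\<epsilon> \<sigma>) {1..d}"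
    and "\<And>\<sigma> i. \<sigma> > 0 \<Longrightarrow> i \<in> {1..d} \<Longrightarrow>
           distributed (M \<sigma>) lborel (\<epsilon> \<sigma> i) (\<lambda>x. ennreal (normal_density 0 \<sigma> x))"
    and "\<And>\<sigma> \<omega> i. X \<sigma> \<omega> i = \<mu> i + \<epsilon> \<sigma> i \<omega>"
    and "\<And>\<sigma> \<omega>. X' \<sigma> \<omega> = blue_proj m d A (X \<sigma> \<omega>)"
  shows "(\<forall>\<sigma>>0. (\<lambda>\<omega>. trop_dist d (\<lambda>i. ereal (X \<sigma> \<omega> i)) (X' \<sigma> \<omega>)) \<in> borel_measurable (M \<sigma>)) \<and>
         ((\<lambda>\<sigma>. \<integral>\<^sup>+\<omega>. e2ennreal (trop_dist d (\<lambda>i. ereal (X \<sigma> \<omega> i)) (X' \<sigma> \<omega>)) \<partial>M \<sigma>)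
            \<longlongrightarrow> 0) (at_right 0)"
proof (intro conjI allI impI)
  have meas: "\<epsilon> \<sigma> i \<in> borel_measurable (M \<sigma>)" if "\<sigma> > 0" "i \<in> {1..d}" for \<sigma> i
    using distributed_measurable[OF assms(7)[OF that]] by simp
  show "(\<lambda>\<omega>. trop_dist d (\<lambda>i. ereal (X \<sigma> \<omega> i)) (X' \<sigma> \<omega>)) \<in> borel_measurable (M \<sigma>)"
    if "\<sigma> > 0" for \<sigma>
  proof -
    have "(\<lambda>\<omega>. X \<sigma> \<omega> i) \<in> borel_measurable (M \<sigma>)" if "i \<in> {1..d}" for i
      unfolding assms(8) using meas[OF \<open>\<sigma> > 0\<close> that] by simp
    then show ?thesis
      unfolding assms(9) by (intro measurable_trop_dist measurable_blue_proj) auto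
  qed
  let ?E = "\<lambda>\<sigma>. \<integral>\<^sup>+\<omega>. e2ennreal (trop_dist d (\<lambda>i. ereal (X \<sigma> \<omega> i)) (X' \<sigma> \<omega>)) \<partial>M \<sigma>"
  define c where "c = 2 * real d * sqrt (2 / pi)"
  have bound: "?E \<sigma> \<le> ennreal (c * \<sigma>)" if "\<sigma> > 0" for \<sigma>
  proof -
    have abs_meas: "(\<lambda>\<omega>. ennreal \<bar>\<epsilon> \<sigma> i \<omega>\<bar>) \<in> borel_measurable (M \<sigma>)" if "i \<in> {1..d}" for i
      using meas[OF \<open>\<sigma> > 0\<close> that] by simp
    have "e2ennreal (trop_dist d (\<lambda>i. ereal (X \<sigma> \<omega> i)) (X' \<sigma> \<omega>))
        \<le> ennreal 2 * (\<Sum>i\<in>{1..d}. ennreal \<bar>\<epsilon> \<sigma> i \<omega>\<bar>)" for \<omega>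
    proof -
      have "\<bar>X \<sigma> \<omega> i - \<mu> i\<bar> \<le> (\<Sum>i\<in>{1..d}. \<bar>\<epsilon> \<sigma> i \<omega>\<bar>)" if "i \<in> {1..d}" for i
        using that unfolding assms(8) by (auto intro!: member_le_sum)
      then have "trop_dist d (\<lambda>i. ereal (X \<sigma> \<omega> i)) (X' \<sigma> \<omega>)
          \<le> ereal (2 * (\<Sum>i\<in>{1..d}. \<bar>\<epsilon> \<sigma> i \<omega>\<bar>))"
        unfolding assms(9) using assms(1-4) by (intro trop_dist_blue_proj_le) auto
      from e2ennreal_mono[OF this] show ?thesis
        by (simp only: e2ennreal_ereal) (simp add: ennreal_mult sum_nonneg)
    qed
    then have "?E \<sigma> \<le> (\<integral>\<^sup>+\<omega>. ennreal 2 * (\<Sum>i\<in>{1..d}. ennreal \<bar>\<epsilon> \<sigma> i \<omega>\<bar>) \<partial>M \<sigma>)"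
      by (intro nn_integral_mono)
    also have "\<dots> = ennreal 2 * (\<Sum>i\<in>{1..d}. \<integral>\<^sup>+\<omega>. ennreal \<bar>\<epsilon> \<sigma> i \<omega>\<bar> \<partial>M \<sigma>)"
      using abs_meas by (simp only: nn_integral_cmult nn_integral_sum borel_measurable_sum)
    also have "\<dots> = ennreal 2 * (\<Sum>i\<in>{1..d}. ennreal (\<sigma> * sqrt (2 / pi)))"
      using nn_integral_abs_centered_normal[OF that assms(7)[OF that]] by simp
    also have "\<dots> = ennreal (2 * (\<Sum>i\<in>{1..d}. \<sigma> * sqrt (2 / pi)))"
      using that by (subst sum_ennreal) (auto simp: ennreal_mult)
    also have "2 * (\<Sum>i\<in>{1..d}. \<sigma> * sqrt (2 / pi)) = c * \<sigma>"
      unfolding c_def by simp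
    finally show ?thesis .
  qed
  show "(?E \<longlongrightarrow> 0) (at_right 0)"
  proof (rule tendsto_sandwich[where f = "\<lambda>_. 0"])
    have "((\<lambda>\<sigma>. c * \<sigma>) \<longlongrightarrow> 0) (at_right 0)"
      by (auto intro!: tendsto_eq_intros)
    then show "((\<lambda>\<sigma>. ennreal (c * \<sigma>)) \<longlongrightarrow> 0) (at_right 0)"
      using tendsto_ennrealI by fastforce
    show "eventually (\<lambda>\<sigma>. ?E \<sigma> \<le> ennreal (c * \<sigma>)) (at_right 0)"
      using eventually_at_right_less[of "0 :: real"] by eventually_elim (rule bound)
  qed auto
qed

end
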